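(* Let $V=\{v_1,\dots,v_m\}\subset\mathbb{R}^d$ be a finite set of points with $\dim\operatorname{conv}(V)=d$ and let $r\in\mathbb{R}^d$. Let $\mathcal{F}=\{F_1,\dots,F_m\}$ be an open (or closed) cover of the sphere $\mathbb{S}^k=\partial\mathbb{B}^{k+1}$ such that there are no $r$-balanced simplices in the nerve $N(\mathcal{F})$. Then $\mathcal{F}$ can be extended to an open (respectively, closed) cover $\mathcal{G}=\{G_1,\dots,G_m\}$ of the ball $\mathbb{B}^{k+1}$ such that there are no $r$-balanced simplices in the nerve $N(\mathcal{G})$ if and only if $[\mathcal{F}_{(V,r)}]=0$ in $\pi_k(\mathbb{S}^{d-1})$.
   Context: Balanced sets: a subset $S\subset V$ is $r$-balanced if $r\in\operatorname{conv}(S)$. Covers: a cover $\mathcal{F}=\{F_1,\dots,F_m\}$ of a space $T$ is indexed by the same indices as $V$, with $F_i$ associated to $v_i$; all its members are open (open cover) or all are closed (closed cover). Its nerve $N(\mathcal{F})$ is the simplicial complex of all $\sigma\subset\{1,\dots,m\}$ with $\bigcap_{i\in\sigma}F_i\neq\emptyset$. A simplex $\sigma\in N(\mathcal{F})$ is $r$-balanced if $\{v_i : i\in\sigma\}$ is $r$-balanced. If $A\subset X$, a cover $\mathcal{G}=\{G_1,\dots,G_m\}$ of $X$ extends a cover $\mathcal{F}=\{F_1,\dots,F_m\}$ of $A$ if $F_i=G_i\cap A$ for all $i$. Homotopy class of a cover: let $\mathcal{F}$ be an open cover of a Hausdorff paracompact space $T$ with no $r$-balanced simplices in $N(\mathcal{F})$.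 Choose a partition of unity $\varphi_1,\dots,\varphi_m$ with $\operatorname{supp}\varphi_i\subset F_i$. Then $\sum_i\varphi_i(x)v_i\neq r$ for all $x\in T$, and with $\tau_r(y)=\frac{y-r}{\|y-r\|}$ for $y\ne r$, the map $g:T\to S^{d-1}$, $g(x)=\tau_r\big(\sum_i\varphi_i(x)v_i\big)$ has homotopy class in $[T,S^{d-1}]$ independent of the partition of unity; this class is denoted $[\mathcal{F}_{(V,r)}]$. For a closed cover $\mathcal{C}$ with no $r$-balanced simplices in $N(\mathcal{C})$, one puts $[\mathcal{C}_{(V,r)}]:=[\mathcal{U}_{(V,r)}]$ for any open cover $\mathcal{U}$ with $C_i\subset U_i$ for all $i$ and $N(\mathcal{U})$ isomorphic to $N(\mathcal{C})$ (such $\mathcal U$ exists and the class does not depend on its choice). The equality $[\mathcal{F}_{(V,r)}]=0$ means that the class is that of a null-homotopic map. *)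

theory Defs
  imports "HOL-Analysis.Analysis"
begin

text \<open>
  Covers are families \<open>F 1, \<dots>, F m\<close> of subsets of a space \<open>T\<close>, which is a set with its subspace
  topology; openness, closedness and supports are relative to \<open>T\<close>. The values of \<open>F\<close> and \<open>v\<close>
  outside \<open>{1..m}\<close> play no role.
\<close>

definition open_cover :: "nat \<Rightarrow> 'b::topological_space set \<Rightarrow> (nat \<Rightarrow> 'b set) \<Rightarrow> bool" where
  "open_cover m T F \<longleftrightarrow>
     (\<forall>i\<in>{1..m}. openin (top_of_set T) (F i)) \<and> (\<Union>i\<in>{1..m}. F i) = T"

definition closed_cover :: "nat \<Rightarrow> 'b::topological_space set \<Rightarrow> (nat \<Rightarrow> 'b set) \<Rightarrow> bool" where
  "closed_cover m T F \<longleftrightarrow>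
     (\<forall>i\<in>{1..m}. closedin (top_of_set T) (F i)) \<and> (\<Union>i\<in>{1..m}. F i) = T"

definition extends_cover :: "nat \<Rightarrow> 'b set \<Rightarrow> (nat \<Rightarrow> 'b set) \<Rightarrow> (nat \<Rightarrow> 'b set) \<Rightarrow> bool" where
  "extends_cover m A F G \<longleftrightarrow> (\<forall>i\<in>{1..m}. F i = G i \<inter> A)"

text \<open>The empty simplex always belongs to the nerve; it is never balanced, since
  \<open>convex hull {} = {}\<close>.\<close>

definition nerve :: "nat \<Rightarrow> (nat \<Rightarrow> 'b set) \<Rightarrow> nat set set" where
  "nerve m F = {\<sigma>. \<sigma> \<subseteq> {1..m} \<and> (\<Inter>i\<in>\<sigma>. F i) \<noteq> {}}"

definition complex_iso :: "nat set set \<Rightarrow> nat set set \<Rightarrow> bool" where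
  "complex_iso K L \<longleftrightarrow> (\<exists>f. bij_betw f (\<Union>K) (\<Union>L) \<and> (\<lambda>\<sigma>. f ` \<sigma>) ` K = L)"

definition balanced :: "'a::real_vector \<Rightarrow> 'a set \<Rightarrow> bool" where
  "balanced r S \<longleftrightarrow> r \<in> convex hull S"

definition no_balanced_simplices ::
    "nat \<Rightarrow> (nat \<Rightarrow> 'a::real_vector) \<Rightarrow> 'a \<Rightarrow> (nat \<Rightarrow> 'b set) \<Rightarrow> bool" where
  "no_balanced_simplices m v r F \<longleftrightarrow> (\<forall>\<sigma>\<in>nerve m F. \<not> balanced r (v ` \<sigma>))"

definition partition_of_unity ::
    "nat \<Rightarrow> 'b::topological_space set \<Rightarrow> (nat \<Rightarrow> 'b set) \<Rightarrow> (nat \<Rightarrow> 'b \<Rightarrow> real) \<Rightarrow> bool" where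
  "partition_of_unity m T F \<phi> \<longleftrightarrow>
     (\<forall>i\<in>{1..m}. continuous_on T (\<phi> i) \<and> (\<forall>x\<in>T. 0 \<le> \<phi> i x) \<and>
        top_of_set T closure_of {x\<in>T. \<phi> i x \<noteq> 0} \<subseteq> F i) \<and>
     (\<forall>x\<in>T. (\<Sum>i=1..m. \<phi> i x) = 1)"

definition radial_proj :: "'a::real_normed_vector \<Rightarrow> 'a \<Rightarrow> 'a" where
  "radial_proj r y = (y - r) /\<^sub>R norm (y - r)"

definition cover_map ::
    "nat \<Rightarrow> (nat \<Rightarrow> 'a::real_normed_vector) \<Rightarrow> 'a \<Rightarrow> (nat \<Rightarrow> 'b \<Rightarrow> real) \<Rightarrow> 'b \<Rightarrow> 'a" where
  "cover_map m v r \<phi> x = radial_proj r (\<Sum>i=1..m. \<phi> i x *\<^sub>R v i)"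

text \<open>An element of \<open>[T, S]\<close> is represented by the set of all maps in it. Two maps from \<open>T\<close> to
  \<open>S\<close> that agree on \<open>T\<close> are homotopic in the sense below, so values outside \<open>T\<close> play no role.\<close>

definition homotopy_class ::
    "'b::topological_space set \<Rightarrow> 'a::topological_space set \<Rightarrow> ('b \<Rightarrow> 'a) \<Rightarrow> ('b \<Rightarrow> 'a) set" where
  "homotopy_class T S f = {g. homotopic_with_canon (\<lambda>_. True) T S f g}"

definition null_class ::
    "'b::topological_space set \<Rightarrow> 'a::topological_space set \<Rightarrow> ('b \<Rightarrow> 'a) set \<Rightarrow> bool" where
  "null_class T S c \<longleftrightarrow> (\<exists>a\<in>S. c = homotopy_class T S (\<lambda>_. a))"

text \<open>The two classes below are meaningful for covers of a paracompact Hausdorff space whose nerve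
  has no balanced simplices; then the choices exist and do not affect the result.\<close>

definition open_cover_class ::
    "nat \<Rightarrow> (nat \<Rightarrow> 'a::real_normed_vector) \<Rightarrow> 'a \<Rightarrow> 'b::topological_space set
       \<Rightarrow> (nat \<Rightarrow> 'b set) \<Rightarrow> ('b \<Rightarrow> 'a) set" where
  "open_cover_class m v r T F =
     homotopy_class T (sphere 0 1) (cover_map m v r (SOME \<phi>. partition_of_unity m T F \<phi>))"

definition closed_cover_class ::
    "nat \<Rightarrow> (nat \<Rightarrow> 'a::real_normed_vector) \<Rightarrow> 'a \<Rightarrow> 'b::topological_space set
       \<Rightarrow> (nat \<Rightarrow> 'b set) \<Rightarrow> ('b \<Rightarrow> 'a) set" where
  "closed_cover_class m v r T C =
     open_cover_class m v r T
       (SOME U. open_cover m T U \<and> (\<forall>i\<in>{1..m}. C i \<subseteq> U i) \<and>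
                complex_iso (nerve m U) (nerve m C))"

end

theory Submission
  imports Defs
begin

text \<open>
  A cover map sends \<open>x\<close> to the direction, seen from \<open>r\<close>, of the point \<open>\<Sum>i. \<phi> i x *\<^sub>R v i\<close>. If the
  cover extends to the ball without balanced simplices, a partition of unity subordinate to the
  extension gives a map of the whole ball to the sphere which restricts to a cover map of \<open>F\<close>; so
  this map is null-homotopic. That the choice of partition of unity is immaterial
  (\<open>cover_map_homotopic\<close>) follows from convexity: two choices give two points in a convex hull that
  misses \<open>r\<close>.

  Conversely, a null-homotopy extends the cover map to a map \<open>n\<close> of the ball. The dimension
  hypothesis makes it possible to choose \<open>n\<close> so that at every point some \<open>v i - r\<close> has positive inner
  product with \<open>n y\<close> (\<open>null_homotopic_through_positive_directions\<close>). The indices \<open>i\<close> with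
  \<open>(v i - r) \<bullet> n y > 0\<close> are unbalanced, because their vertices lie strictly on one side of a hyperplane
  through \<open>r\<close>; so the sets where these inner products are positive form an open cover of the ball
  without balanced simplices. On the sphere it has to agree with \<open>F\<close>. For this the inner products are
  multiplied by weights that restrict to the partition of unity on the sphere
  (\<open>null_homotopic_imp_unbalanced_scores\<close>), which makes the trace of the new cover on the sphere
  smaller than \<open>F\<close>; a collar on which the members of \<open>F\<close> are extended radially then restores \<open>F\<close>
  exactly (\<open>open_cover_extension_from_scores\<close>).

  For closed covers, a compactness argument gives an open swelling with the same nerve
  (\<open>closed_cover_swelling\<close>). Any two open covers that contain the closed cover and have no balanced
  simplices define the same class, since their intersection still covers
  (\<open>cover_map_homotopic_common_subcover\<close>). In the construction of the extension, the sets of positive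
  score are replaced by the closed sets of maximal score
  (\<open>closed_cover_extension_from_scores\<close>).
\<close>

section \<open>Unbalanced covers and partitions of unity\<close>

text \<open>Every simplex of the nerve lies in the set of all indices whose members contain a common point
  \<open>x\<close>, so balancedness need only be tested on these sets, one for each point.\<close>

lemma no_balanced_simplices_iff:
  "no_balanced_simplices m v r F \<longleftrightarrow> (\<forall>x. r \<notin> convex hull (v ` {i\<in>{1..m}. x \<in> F i}))"
proof
  assume *: "no_balanced_simplices m v r F"
  show "\<forall>x. r \<notin> convex hull (v ` {i\<in>{1..m}. x \<in> F i})"
  proof
    fix x
    have "{i\<in>{1..m}. x \<in> F i} \<in> nerve m F"
      by (auto simp: nerve_def)
    with * show "r \<notin> convex hull (v ` {i\<in>{1..m}. x \<in> F i})"
      unfolding no_balanced_simplices_def balanced_def by blast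
  qed
next
  assume *: "\<forall>x. r \<notin> convex hull (v ` {i\<in>{1..m}. x \<in> F i})"
  show "no_balanced_simplices m v r F"
    unfolding no_balanced_simplices_def balanced_def
  proof
    fix \<sigma> assume "\<sigma> \<in> nerve m F"
    then obtain x where "\<sigma> \<subseteq> {1..m}" "x \<in> (\<Inter>i\<in>\<sigma>. F i)"
      unfolding nerve_def by blast
    then have x: "\<sigma> \<subseteq> {i\<in>{1..m}. x \<in> F i}"
      by blast
    show "r \<notin> convex hull (v ` \<sigma>)"
      using * hull_mono[OF image_mono[OF x], of convex v] by blast
  qed
qed

lemma nerve_mono:
  assumes "\<And>i. i \<in> {1..m} \<Longrightarrow> F i \<subseteq> G i"
  shows "nerve m F \<subseteq> nerve m G"
proof
  fix \<sigma> assume "\<sigma> \<in> nerve m F"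
  then obtain x where "\<sigma> \<subseteq> {1..m}" "x \<in> (\<Inter>i\<in>\<sigma>. F i)"
    unfolding nerve_def by blast
  then have "\<sigma> \<subseteq> {1..m}" "x \<in> (\<Inter>i\<in>\<sigma>. G i)"
    using assms by blast+
  then show "\<sigma> \<in> nerve m G"
    unfolding nerve_def by blast
qed

lemma unbalanced_subset:
  assumes "\<sigma> \<subseteq> \<tau>" "r \<notin> convex hull (v ` \<tau>)"
  shows "r \<notin> convex hull (v ` \<sigma>)"
  using assms(2) hull_mono[OF image_mono[OF assms(1)], of convex v] by blast

lemma no_balanced_simplices_mono:
  assumes "no_balanced_simplices m v r G" "\<And>i. i \<in> {1..m} \<Longrightarrow> F i \<subseteq> G i"
  shows "no_balanced_simplices m v r F"
  using assms(1) nerve_mono[of m F G, OF assms(2)]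
  unfolding no_balanced_simplices_def by blast

lemma partition_of_unity_in_cover:
  assumes "partition_of_unity m T F \<phi>" "i \<in> {1..m}" "x \<in> T" "\<phi> i x \<noteq> 0"
  shows "x \<in> F i"
proof -
  have "{x\<in>T. \<phi> i x \<noteq> 0} \<subseteq> top_of_set T closure_of {x\<in>T. \<phi> i x \<noteq> 0}"
    by (rule closure_of_subset) auto
  with assms show ?thesis
    unfolding partition_of_unity_def by blast
qed

lemma partition_of_unity_cover_mono:
  assumes "partition_of_unity m T F \<phi>" "\<And>i. i \<in> {1..m} \<Longrightarrow> F i \<subseteq> G i"
  shows "partition_of_unity m T G \<phi>"
  using assms unfolding partition_of_unity_def by (meson subset_trans)

lemma partition_of_unity_restrict:
  assumes "partition_of_unity m T G \<phi>" "A \<subseteq> T"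
  shows "partition_of_unity m A (\<lambda>i. G i \<inter> A) \<phi>"
proof -
  have "top_of_set A closure_of {x\<in>A. \<phi> i x \<noteq> 0} \<subseteq> G i \<inter> A" if "i \<in> {1..m}" for i
  proof -
    have "top_of_set A closure_of {x\<in>A. \<phi> i x \<noteq> 0} \<subseteq> top_of_set T closure_of {x\<in>A. \<phi> i x \<noteq> 0}"
      by (rule closure_of_subtopology_mono[OF assms(2)])
    also have "\<dots> \<subseteq> top_of_set T closure_of {x\<in>T. \<phi> i x \<noteq> 0}"
      using assms(2) by (intro closure_of_mono) auto
    also have "\<dots> \<subseteq> G i"
      using assms(1) that by (auto simp: partition_of_unity_def)
    finally show ?thesis
      using closure_of_subset_topspace[of "top_of_set A"] by auto
  qed
  then show ?thesis
    using assms unfolding partition_of_unity_def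
    by (auto intro: continuous_on_subset)
qed

text \<open>Start from the distances \<open>e i\<close> to the complements of the members, whose sum \<open>s\<close> is positive.
  Since some \<open>e i\<close> is at least \<open>s / m\<close>, cutting each \<open>e i\<close> off at the lower level \<open>s / (2 m)\<close>
  keeps the sum positive, and it moves the supports into the closed sets
  \<open>{x. s x / (2 m) \<le> e i x}\<close>, hence into the members.\<close>

lemma partition_of_unity_exists:
  fixes U :: "nat \<Rightarrow> 'b::metric_space set"
  assumes U: "open_cover m T U"
  obtains \<phi> where "partition_of_unity m T U \<phi>"
proof -
  define e where "e i x = (if T \<subseteq> U i then 1 else infdist x (T - U i))" for i and x :: 'b
  define s where "s x = (\<Sum>i=1..m. e i x)" for x
  define c where "c i x = max 0 (e i x - s x / (2 * real m))" for i x
  define \<phi> where "\<phi> i x = c i x / (\<Sum>j=1..m. c j x)" for i x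
  have e_cont: "continuous_on T (e i)" for i
    unfolding e_def by (cases "T \<subseteq> U i") (auto intro!: continuous_intros)
  have e_nonneg: "0 \<le> e i x" for i x
    by (simp add: e_def infdist_nonneg)
  have e_pos: "0 < e i x \<longleftrightarrow> x \<in> U i" if "i \<in> {1..m}" "x \<in> T" for i x
  proof (cases "T \<subseteq> U i")
    case True
    then show ?thesis using that by (auto simp: e_def)
  next
    case False
    obtain O' where O': "open O'" "U i = T \<inter> O'"
      using U \<open>i \<in> {1..m}\<close> unfolding open_cover_def openin_open by blast
    have "x \<in> closure (T - U i) \<longleftrightarrow> x \<notin> U i"
    proof
      assume "x \<in> closure (T - U i)"
      moreover have "closure (T - U i) \<subseteq> - O'"
        using O' by (intro closure_minimal) auto
      ultimately show "x \<notin> U i" using O' by auto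
    qed (use that closure_subset in blast)
    moreover have "x \<in> closure (T - U i) \<longleftrightarrow> infdist x (T - U i) = 0"
      using False by (intro in_closure_iff_infdist_zero) auto
    ultimately show ?thesis
      using False infdist_nonneg[of x "T - U i"] by (auto simp: e_def less_le)
  qed
  have s_cont: "continuous_on T s"
    unfolding s_def by (intro continuous_intros e_cont)
  have s_pos: "0 < s x" if "x \<in> T" for x
  proof -
    have "x \<in> (\<Union>i\<in>{1..m}. U i)"
      using U that by (simp add: open_cover_def)
    then obtain i where i: "i \<in> {1..m}" "x \<in> U i" ..
    then have "0 < e i x"
      using e_pos that by blast
    with i(1) show ?thesis
      unfolding s_def by (intro sum_pos2[of _ i] e_nonneg) auto
  qed
  have c_cont: "continuous_on T (c i)" for i
  proof (cases "m = 0")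
    case True
    then show ?thesis unfolding c_def by (auto intro!: continuous_intros e_cont)
  next
    case False
    then show ?thesis unfolding c_def by (auto intro!: continuous_intros e_cont s_cont)
  qed
  have c_nonneg: "0 \<le> c i x" for i x
    by (simp add: c_def)
  have c_sum_pos: "0 < (\<Sum>j=1..m. c j x)" if x: "x \<in> T" for x
  proof -
    have "m \<noteq> 0"
      using s_pos[OF x] by (intro notI) (simp add: s_def)
    have "\<exists>i\<in>{1..m}. s x / (2 * real m) < e i x"
    proof (rule ccontr)
      assume "\<not> ?thesis"
      then have "s x \<le> (\<Sum>i=1..m. s x / (2 * real m))"
        unfolding s_def[of x] by (intro sum_mono) (auto simp: s_def not_less)
      also have "\<dots> = s x / 2"
        using \<open>m \<noteq> 0\<close> by simp
      finally show False using s_pos[OF x] by simp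
    qed
    then obtain i where "i \<in> {1..m}" "0 < c i x"
      by (auto simp: c_def)
    then show ?thesis
      using c_nonneg by (intro sum_pos2[of _ i]) auto
  qed
  have "top_of_set T closure_of {x\<in>T. \<phi> i x \<noteq> 0} \<subseteq> U i" if i: "i \<in> {1..m}" for i
  proof -
    have "{x\<in>T. \<phi> i x \<noteq> 0} \<subseteq> T \<inter> (\<lambda>x. e i x - s x / (2 * real m)) -` {0..}"
      by (auto simp: \<phi>_def c_def max_def split: if_splits)
    moreover have "closedin (top_of_set T) (T \<inter> (\<lambda>x. e i x - s x / (2 * real m)) -` {0..})"
      using i by (intro continuous_closedin_preimage continuous_intros e_cont s_cont) auto
    ultimately have "top_of_set T closure_of {x\<in>T. \<phi> i x \<noteq> 0}
        \<subseteq> T \<inter> (\<lambda>x. e i x - s x / (2 * real m)) -` {0..}"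
      by (rule closure_of_minimal)
    also have "\<dots> \<subseteq> U i"
    proof clarsimp
      fix x assume x: "x \<in> T" "s x / (2 * real m) \<le> e i x"
      have "0 < s x / (2 * real m)"
        using s_pos[OF x(1)] i by simp
      with x show "x \<in> U i"
        using e_pos[OF i x(1)] by simp
    qed
    finally show ?thesis .
  qed
  moreover have "continuous_on T (\<phi> i)" for i
    unfolding \<phi>_def using c_sum_pos by (intro continuous_intros c_cont) (metis less_irrefl)
  moreover have "0 \<le> \<phi> i x" for i x
    by (simp add: \<phi>_def c_nonneg sum_nonneg)
  moreover have "(\<Sum>i=1..m. \<phi> i x) = 1" if "x \<in> T" for x
    using c_sum_pos[OF that] by (simp add: \<phi>_def flip: sum_divide_distrib)
  ultimately have "partition_of_unity m T U \<phi>"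
    by (simp add: partition_of_unity_def)
  then show thesis ..
qed

section \<open>The map of a cover up to homotopy\<close>

lemma partition_of_unity_sum_in_hull:
  assumes "partition_of_unity m T F \<phi>" "x \<in> T"
  shows "(\<Sum>i=1..m. \<phi> i x *\<^sub>R v i) \<in> convex hull (v ` {i\<in>{1..m}. x \<in> F i})"
proof -
  let ?I = "{i\<in>{1..m}. x \<in> F i}"
  have zero: "\<phi> i x = 0" if "i \<in> {1..m} - ?I" for i
    using partition_of_unity_in_cover[OF assms(1) _ assms(2)] that by auto
  have "(\<Sum>i\<in>?I. \<phi> i x) = (\<Sum>i=1..m. \<phi> i x)"
    using zero by (intro sum.mono_neutral_left) auto
  also have "\<dots> = 1"
    using assms by (simp add: partition_of_unity_def)
  finally have one: "(\<Sum>i\<in>?I. \<phi> i x) = 1" .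
  have "(\<Sum>i=1..m. \<phi> i x *\<^sub>R v i) = (\<Sum>i\<in>?I. \<phi> i x *\<^sub>R v i)"
    using zero by (intro sum.mono_neutral_right) auto
  also have "\<dots> \<in> convex hull (v ` ?I)"
    using one assms by (intro convex_sum) (auto simp: partition_of_unity_def hull_inc)
  finally show ?thesis .
qed

lemma continuous_on_radial_proj: "continuous_on (- {r}) (radial_proj r)"
  unfolding radial_proj_def by (intro continuous_intros) auto

text \<open>Two partitions of unity subordinate to the same cover give, at each point, two points of one
  and the same convex hull, which misses \<open>r\<close>; so the segment between them misses \<open>r\<close> as well.\<close>

lemma cover_map_homotopic:
  fixes T :: "'b::topological_space set" and v :: "nat \<Rightarrow> 'a::real_normed_vector"
  assumes "no_balanced_simplices m v r F"
    and \<phi>: "partition_of_unity m T F \<phi>" and \<psi>: "partition_of_unity m T F \<psi>"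
  shows "homotopic_with_canon (\<lambda>_. True) T (sphere 0 1) (cover_map m v r \<phi>) (cover_map m v r \<psi>)"
proof -
  define s where "s \<theta> x = (\<Sum>i=1..m. \<theta> i x *\<^sub>R v i)" for \<theta> :: "nat \<Rightarrow> 'b \<Rightarrow> real" and x
  have cont: "continuous_on T (s \<theta>)" if "partition_of_unity m T F \<theta>" for \<theta>
    using that unfolding partition_of_unity_def s_def by (auto intro!: continuous_intros)
  have "homotopic_with_canon (\<lambda>_. True) T (- {r}) (s \<phi>) (s \<psi>)"
  proof (rule homotopic_with_linear[OF cont[OF \<phi>] cont[OF \<psi>]])
    fix x assume "x \<in> T"
    let ?H = "convex hull (v ` {i\<in>{1..m}. x \<in> F i})"
    have "closed_segment (s \<phi> x) (s \<psi> x) \<subseteq> ?H"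
      using partition_of_unity_sum_in_hull[OF \<phi> \<open>x \<in> T\<close>] partition_of_unity_sum_in_hull[OF \<psi> \<open>x \<in> T\<close>]
      unfolding s_def by (intro closed_segment_subset) auto
    moreover have "r \<notin> ?H"
      using assms(1) by (simp add: no_balanced_simplices_iff)
    ultimately show "closed_segment (s \<phi> x) (s \<psi> x) \<subseteq> - {r}"
      by blast
  qed
  then have "homotopic_with_canon (\<lambda>_. True) T (sphere 0 1)
      (radial_proj r \<circ> s \<phi>) (radial_proj r \<circ> s \<psi>)"
    by (rule homotopic_with_compose_continuous_left[OF _ continuous_on_radial_proj])
       (auto simp: radial_proj_def)
  moreover have "radial_proj r \<circ> s \<theta> = cover_map m v r \<theta>" for \<theta>
    by (simp add: fun_eq_iff cover_map_def s_def)
  ultimately show ?thesis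
    by (simp only:)
qed

lemma cover_map_into_sphere:
  assumes "no_balanced_simplices m v r F" "partition_of_unity m T F \<phi>"
  shows "continuous_on T (cover_map m v r \<phi>)" "cover_map m v r \<phi> \<in> T \<rightarrow> sphere 0 1"
  using cover_map_homotopic[OF assms assms(2)]
    homotopic_with_imp_continuous homotopic_with_imp_funspace1 by blast+

text \<open>A partition of unity for the cover by the sets \<open>U i \<inter> U' i\<close> is subordinate to both covers. The
  common part \<open>C\<close> serves to make these sets cover \<open>T\<close>.\<close>

lemma cover_map_homotopic_common_subcover:
  fixes T :: "'b::metric_space set"
  assumes U: "open_cover m T U" "no_balanced_simplices m v r U" "partition_of_unity m T U \<phi>"
    and U': "open_cover m T U'" "no_balanced_simplices m v r U'" "partition_of_unity m T U' \<psi>"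
    and C: "\<And>i. i \<in> {1..m} \<Longrightarrow> C i \<subseteq> U i" "\<And>i. i \<in> {1..m} \<Longrightarrow> C i \<subseteq> U' i" "(\<Union>i\<in>{1..m}. C i) = T"
  shows "homotopic_with_canon (\<lambda>_. True) T (sphere 0 1) (cover_map m v r \<phi>) (cover_map m v r \<psi>)"
proof -
  have "(\<Union>i\<in>{1..m}. U i \<inter> U' i) = T"
  proof
    show "T \<subseteq> (\<Union>i\<in>{1..m}. U i \<inter> U' i)"
      using C by blast
    show "(\<Union>i\<in>{1..m}. U i \<inter> U' i) \<subseteq> T"
      using U(1) unfolding open_cover_def by blast
  qed
  then have "open_cover m T (\<lambda>i. U i \<inter> U' i)"
    using U(1) U'(1) by (auto simp: open_cover_def)
  then obtain \<theta> where \<theta>: "partition_of_unity m T (\<lambda>i. U i \<inter> U' i) \<theta>"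
    by (rule partition_of_unity_exists)
  have "partition_of_unity m T U \<theta>" "partition_of_unity m T U' \<theta>"
    by (rule partition_of_unity_cover_mono[OF \<theta>], blast)+
  then show ?thesis
    using cover_map_homotopic[OF U(2,3)] cover_map_homotopic[OF U'(2) _ U'(3)]
    by (blast intro: homotopic_with_trans)
qed

lemma null_homotopy_class_iff:
  assumes "T \<noteq> {}" "continuous_on T f" "f \<in> T \<rightarrow> S"
  shows "null_class T S (homotopy_class T S f) \<longleftrightarrow>
    (\<exists>a. homotopic_with_canon (\<lambda>_. True) T S f (\<lambda>_. a))"
proof
  assume "null_class T S (homotopy_class T S f)"
  then obtain a where a: "a \<in> S" "homotopy_class T S f = homotopy_class T S (\<lambda>_. a)"
    by (auto simp: null_class_def)
  have "homotopic_with_canon (\<lambda>_. True) T S (\<lambda>_. a) (\<lambda>_. a)"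
    using a by auto
  then have "(\<lambda>_. a) \<in> homotopy_class T S f"
    using a by (simp add: homotopy_class_def)
  then show "\<exists>a. homotopic_with_canon (\<lambda>_. True) T S f (\<lambda>_. a)"
    by (auto simp: homotopy_class_def)
next
  assume "\<exists>a. homotopic_with_canon (\<lambda>_. True) T S f (\<lambda>_. a)"
  then obtain a where a: "homotopic_with_canon (\<lambda>_. True) T S f (\<lambda>_. a)" ..
  then have "a \<in> S"
    using homotopic_with_imp_subset2[OF a] assms(1) by blast
  moreover have "homotopy_class T S f = homotopy_class T S (\<lambda>_. a)"
    unfolding homotopy_class_def using a homotopic_with_trans homotopic_with_symD by blast
  ultimately show "null_class T S (homotopy_class T S f)"
    unfolding null_class_def by blast
qed

lemma null_open_cover_class_iff:
  assumes "T \<noteq> {}" and nb: "no_balanced_simplices m v r U" and \<phi>: "partition_of_unity m T U \<phi>"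
  shows "null_class T (sphere 0 1) (open_cover_class m v r T U) \<longleftrightarrow>
    (\<exists>a. homotopic_with_canon (\<lambda>_. True) T (sphere 0 1) (cover_map m v r \<phi>) (\<lambda>_. a))"
proof -
  let ?\<phi> = "SOME \<phi>. partition_of_unity m T U \<phi>"
  have some: "partition_of_unity m T U ?\<phi>"
    using \<phi> by (rule someI[of "partition_of_unity m T U"])
  have "null_class T (sphere 0 1) (open_cover_class m v r T U) \<longleftrightarrow>
    (\<exists>a. homotopic_with_canon (\<lambda>_. True) T (sphere 0 1) (cover_map m v r ?\<phi>) (\<lambda>_. a))"
    unfolding open_cover_class_def
    by (rule null_homotopy_class_iff[OF assms(1) cover_map_into_sphere[OF nb some]])
  also have "\<dots> \<longleftrightarrow>
    (\<exists>a. homotopic_with_canon (\<lambda>_. True) T (sphere 0 1) (cover_map m v r \<phi>) (\<lambda>_. a))"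
    using cover_map_homotopic[OF nb some \<phi>] cover_map_homotopic[OF nb \<phi> some]
    by (blast intro: homotopic_with_trans)
  finally show ?thesis .
qed

section \<open>Open swellings of closed covers\<close>

text \<open>If the closed sets \<open>C i\<close>, \<open>i \<in> \<sigma>\<close>, have no common point, then the sum of the distances to them
  has a positive minimum over the compact space, so small neighbourhoods of them have no common
  point either. As there are finitely many \<open>\<sigma>\<close>, one radius serves them all.\<close>

lemma closed_cover_swelling:
  fixes C :: "nat \<Rightarrow> 'b::metric_space set"
  assumes "compact T" and C: "closed_cover m T C"
  obtains U where "open_cover m T U" "\<And>i. i \<in> {1..m} \<Longrightarrow> C i \<subseteq> U i" "nerve m U = nerve m C"
proof -
  define N where "N \<delta> i = T \<inter> (\<Union>c\<in>C i. ball c \<delta>)" for \<delta> i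
  have C_sub: "C i \<subseteq> T" if "i \<in> {1..m}" for i
    using C that unfolding closed_cover_def by blast
  have C_closed: "closed (C i)" if "i \<in> {1..m}" for i
    using C that compact_imp_closed[OF \<open>compact T\<close>] closedin_closed_trans
    unfolding closed_cover_def by blast
  have ev: "\<forall>\<^sub>F \<delta> in at_right 0. \<sigma> \<notin> nerve m C \<longrightarrow> (\<Inter>i\<in>\<sigma>. N \<delta> i) = {}" if \<sigma>: "\<sigma> \<in> Pow {1..m}" for \<sigma>
  proof (cases "\<sigma> \<in> nerve m C")
    case False
    then have "\<sigma> \<noteq> {}"
      by (auto simp: nerve_def)
    have fin: "finite \<sigma>"
      using \<sigma> finite_subset by auto
    have empty: "(\<Inter>i\<in>\<sigma>. C i) = {}"
      using False \<sigma> by (auto simp: nerve_def)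
    show ?thesis
    proof (cases "T = {} \<or> (\<exists>i\<in>\<sigma>. C i = {})")
      case True
      then have "(\<Inter>i\<in>\<sigma>. N \<delta> i) = {}" for \<delta>
        using \<open>\<sigma> \<noteq> {}\<close> by (fastforce simp: N_def)
      then show ?thesis by simp
    next
      case ne: False
      define f where "f x = (\<Sum>i\<in>\<sigma>. infdist x (C i))" for x
      have "continuous_on T f"
        unfolding f_def by (intro continuous_intros)
      then obtain x0 where x0: "x0 \<in> T" "\<And>x. x \<in> T \<Longrightarrow> f x0 \<le> f x"
        using continuous_attains_inf[of T f] \<open>compact T\<close> ne by auto
      have "f x0 \<noteq> 0"
      proof
        assume "f x0 = 0"
        then have "\<forall>i\<in>\<sigma>. infdist x0 (C i) = 0"
          unfolding f_def using fin by (simp add: sum_nonneg_eq_0_iff infdist_nonneg)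
        then have "\<forall>i\<in>\<sigma>. x0 \<in> C i"
          using ne \<sigma> C_closed by (metis PowD in_closed_iff_infdist_zero subsetD)
        then show False using empty by blast
      qed
      moreover have "0 \<le> f x0"
        unfolding f_def by (intro sum_nonneg infdist_nonneg)
      ultimately have pos: "0 < f x0" by simp
      have card: "0 < card \<sigma>"
        using fin \<open>\<sigma> \<noteq> {}\<close> by (simp add: card_gt_0_iff)
      have "(\<Inter>i\<in>\<sigma>. N \<delta> i) = {}" if \<delta>: "\<delta> < f x0 / card \<sigma>" for \<delta>
      proof (rule equals0I)
        fix x assume x: "x \<in> (\<Inter>i\<in>\<sigma>. N \<delta> i)"
        have "infdist x (C i) \<le> \<delta>" if "i \<in> \<sigma>" for i
        proof -
          have "x \<in> (\<Union>c\<in>C i. ball c \<delta>)"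
            using x that unfolding N_def by blast
          then obtain c where "c \<in> C i" "dist c x < \<delta>"
            by auto
          then show ?thesis
            by (intro infdist_le2[of c]) (auto simp: dist_commute)
        qed
        then have "f x \<le> (\<Sum>i\<in>\<sigma>. \<delta>)"
          unfolding f_def by (intro sum_mono)
        also have "\<dots> < f x0"
          using \<delta> card by (simp add: field_simps)
        finally have "f x < f x0" .
        moreover have "x \<in> T"
          using x \<open>\<sigma> \<noteq> {}\<close> by (auto simp: N_def)
        ultimately show False
          using x0(2) by fastforce
      qed
      moreover have "\<forall>\<^sub>F \<delta> in at_right 0. \<delta> < f x0 / card \<sigma>"
        using eventually_at_right_real[of 0 "f x0 / card \<sigma>"] pos card
        by (auto elim!: eventually_mono)
      ultimately show ?thesis
        by (auto elim!: eventually_mono)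
    qed
  qed simp
  have "\<forall>\<^sub>F \<delta> in at_right (0::real). 0 < \<delta> \<and>
      (\<forall>\<sigma>\<in>Pow {1..m}. \<sigma> \<notin> nerve m C \<longrightarrow> (\<Inter>i\<in>\<sigma>. N \<delta> i) = {})"
    using eventually_ball_finite[of "Pow {1..m}", OF _ ballI[OF ev]]
    by (intro eventually_conj eventually_at_right_less) simp
  then have "\<exists>\<delta>>0. \<forall>\<sigma>\<in>Pow {1..m}. \<sigma> \<notin> nerve m C \<longrightarrow> (\<Inter>i\<in>\<sigma>. N \<delta> i) = {}"
    by (rule eventually_happens'[OF trivial_limit_at_right_real])
  then obtain \<delta> where \<delta>: "0 < \<delta>"
      "\<And>\<sigma>. \<sigma> \<in> Pow {1..m} \<Longrightarrow> \<sigma> \<notin> nerve m C \<Longrightarrow> (\<Inter>i\<in>\<sigma>. N \<delta> i) = {}"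
    by blast
  have sub: "C i \<subseteq> N \<delta> i" if "i \<in> {1..m}" for i
    using C_sub[OF that] \<delta>(1) by (auto simp: N_def)
  have "open_cover m T (N \<delta>)"
  proof -
    have "(\<Union>i\<in>{1..m}. N \<delta> i) = T"
    proof
      show "T \<subseteq> (\<Union>i\<in>{1..m}. N \<delta> i)"
        using C sub unfolding closed_cover_def by blast
    qed (auto simp: N_def)
    then show ?thesis
      unfolding open_cover_def N_def by (auto intro!: openin_open_Int)
  qed
  moreover have "nerve m (N \<delta>) = nerve m C"
  proof
    show "nerve m (N \<delta>) \<subseteq> nerve m C"
      using \<delta>(2) unfolding nerve_def by auto
    show "nerve m C \<subseteq> nerve m (N \<delta>)"
      using sub by (rule nerve_mono)
  qed
  ultimately show thesis
    using sub that by blast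
qed

text \<open>An isomorphism of finite complexes preserves the number of simplices, so it forces equality
  when one complex contains the other.\<close>

lemma complex_iso_subset_eq:
  assumes "complex_iso L K" "K \<subseteq> L" "finite L"
  shows "L = K"
proof -
  obtain f where f: "bij_betw f (\<Union>L) (\<Union>K)" "(\<lambda>\<sigma>. f ` \<sigma>) ` L = K"
    using assms(1) by (auto simp: complex_iso_def)
  have "inj_on (\<lambda>\<sigma>. f ` \<sigma>) L"
    using f(1) by (intro inj_on_image) (simp add: bij_betw_def)
  then have "card K = card L"
    using f(2) card_image by blast
  with assms show ?thesis
    using card_subset_eq by metis
qed

text \<open>The swelling chosen in the definition of the class has the nerve of \<open>C\<close>, but the class can be
  computed from any open cover that contains \<open>C\<close> and has no balanced simplices.\<close>

lemma null_closed_cover_class_iff: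
  fixes C :: "nat \<Rightarrow> 'b::metric_space set"
  assumes T: "T \<noteq> {}" "compact T"
    and C: "closed_cover m T C" "no_balanced_simplices m v r C"
    and U: "open_cover m T U" "\<And>i. i \<in> {1..m} \<Longrightarrow> C i \<subseteq> U i" "no_balanced_simplices m v r U"
    and \<phi>: "partition_of_unity m T U \<phi>"
  shows "null_class T (sphere 0 1) (closed_cover_class m v r T C) \<longleftrightarrow>
    (\<exists>a. homotopic_with_canon (\<lambda>_. True) T (sphere 0 1) (cover_map m v r \<phi>) (\<lambda>_. a))"
proof -
  let ?P = "\<lambda>U. open_cover m T U \<and> (\<forall>i\<in>{1..m}. C i \<subseteq> U i) \<and> complex_iso (nerve m U) (nerve m C)"
  define U' where "U' = (SOME U. ?P U)"
  have "\<exists>U. ?P U"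
  proof -
    obtain W where W: "open_cover m T W" "\<And>i. i \<in> {1..m} \<Longrightarrow> C i \<subseteq> W i" "nerve m W = nerve m C"
      using closed_cover_swelling[OF T(2) C(1)] by blast
    have "complex_iso (nerve m C) (nerve m C)"
      unfolding complex_iso_def by (rule exI[of _ id]) auto
    with W have "?P W" by auto
    then show ?thesis by (rule exI[of ?P W])
  qed
  then have U': "?P U'"
    unfolding U'_def by (rule someI_ex)
  have "nerve m C \<subseteq> nerve m U'"
    using U' by (intro nerve_mono) blast
  moreover have "finite (nerve m U')"
    by (rule finite_subset[of _ "Pow {1..m}"]) (auto simp: nerve_def)
  ultimately have "nerve m U' = nerve m C"
    using U' complex_iso_subset_eq by blast
  then have nb: "no_balanced_simplices m v r U'"
    using C(2) by (simp add: no_balanced_simplices_def)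
  obtain \<psi> where \<psi>: "partition_of_unity m T U' \<psi>"
    using U' partition_of_unity_exists by blast
  have hom: "homotopic_with_canon (\<lambda>_. True) T (sphere 0 1) (cover_map m v r \<phi>) (cover_map m v r \<psi>)"
    using U' C(1) U(2)
    by (intro cover_map_homotopic_common_subcover[OF U(1,3) \<phi> _ nb \<psi>, of C])
       (auto simp: closed_cover_def)
  have "null_class T (sphere 0 1) (closed_cover_class m v r T C) \<longleftrightarrow>
    (\<exists>a. homotopic_with_canon (\<lambda>_. True) T (sphere 0 1) (cover_map m v r \<psi>) (\<lambda>_. a))"
    unfolding closed_cover_class_def U'_def[symmetric]
    by (rule null_open_cover_class_iff[OF T(1) nb \<psi>])
  also have "\<dots> \<longleftrightarrow>
    (\<exists>a. homotopic_with_canon (\<lambda>_. True) T (sphere 0 1) (cover_map m v r \<phi>) (\<lambda>_. a))"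
    using hom homotopic_with_symD[OF hom] by (blast intro: homotopic_with_trans)
  finally show ?thesis .
qed

section \<open>Scores on the ball from a null-homotopy\<close>

text \<open>Expanding one factor of \<open>n \<bullet> n > 0\<close> gives a sum of \<open>c i * ((v i - r) \<bullet> n)\<close>, and one of its
  terms is positive.\<close>

lemma positive_direction_exists:
  fixes v :: "nat \<Rightarrow> 'a::real_inner"
  assumes "n = (\<Sum>i=1..m. c i *\<^sub>R (v i - r))" "n \<noteq> 0" "\<And>i. i \<in> {1..m} \<Longrightarrow> 0 \<le> c i"
  obtains i where "i \<in> {1..m}" "0 < c i" "0 < (v i - r) \<bullet> n"
proof -
  have "n \<bullet> n = (\<Sum>i=1..m. c i * ((v i - r) \<bullet> n))"
    by (subst (1) assms(1)) (simp add: inner_sum_left)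
  moreover have "0 < n \<bullet> n"
    using assms(2) by simp
  moreover have "(\<Sum>i=1..m. c i * ((v i - r) \<bullet> n)) \<le> 0"
    if "\<forall>i\<in>{1..m}. \<not> 0 < c i * ((v i - r) \<bullet> n)"
    using that by (intro sum_nonpos) (auto simp: not_less)
  ultimately obtain i where i: "i \<in> {1..m}" "0 < c i * ((v i - r) \<bullet> n)"
    by fastforce
  then show thesis
    using assms(3)[OF i(1)] that[OF i(1)] by (auto simp: zero_less_mult_iff)
qed

text \<open>The weights of a partition of unity sum to one, so \<open>r\<close> may be subtracted from each vertex.
  Here \<open>t\<close> is the normalising factor of the radial projection.\<close>

lemma cover_map_cone:
  assumes "partition_of_unity m T F \<phi>" "x \<in> T"
  obtains t where "0 \<le> t" "cover_map m v r \<phi> x = (\<Sum>i=1..m. (t * \<phi> i x) *\<^sub>R (v i - r))"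
proof
  define y where "y = (\<Sum>i=1..m. \<phi> i x *\<^sub>R v i)"
  have "(\<Sum>i=1..m. \<phi> i x *\<^sub>R (v i - r)) = y - (\<Sum>i=1..m. \<phi> i x) *\<^sub>R r"
    by (simp add: y_def scaleR_diff_right sum_subtractf scaleR_left.sum)
  also have "\<dots> = y - r"
    using assms by (simp add: partition_of_unity_def)
  finally have sum: "(\<Sum>i=1..m. \<phi> i x *\<^sub>R (v i - r)) = y - r" .
  have "cover_map m v r \<phi> x = inverse (norm (y - r)) *\<^sub>R (y - r)"
    by (simp add: cover_map_def radial_proj_def y_def)
  also have "\<dots> = (\<Sum>i=1..m. (inverse (norm (y - r)) * \<phi> i x) *\<^sub>R (v i - r))"
    by (subst (2) sum[symmetric]) (simp only: scaleR_sum_right scaleR_scaleR)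
  finally show "cover_map m v r \<phi> x = (\<Sum>i=1..m. (inverse (norm (y - r)) * \<phi> i x) *\<^sub>R (v i - r))" .
qed simp

text \<open>Call a direction \<open>n\<close> positive if some \<open>v i - r\<close> has positive inner product with it. Either
  every nonzero direction is positive (\<open>r\<close> is interior to the convex hull), and the given
  null-homotopy already runs through positive directions; or some \<open>w \<noteq> 0\<close> satisfies
  \<open>(v i - r) \<bullet> w \<ge> 0\<close> for all \<open>i\<close>. In the second case the hull is full-dimensional, so some
  \<open>v j - r\<close> is strictly on the side of \<open>w\<close>, and the straight homotopy to it stays positive.\<close>

lemma null_homotopic_through_positive_directions:
  fixes v :: "nat \<Rightarrow> 'a::euclidean_space"
  assumes \<phi>: "partition_of_unity m T U \<phi>" and nb: "no_balanced_simplices m v r U"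
    and null: "homotopic_with_canon (\<lambda>_. True) T (sphere 0 1) (cover_map m v r \<phi>) (\<lambda>_. a)"
    and dim: "aff_dim (v ` {1..m}) = int DIM('a)"
  shows "\<exists>c. homotopic_with_canon (\<lambda>_. True) T {n. \<exists>i\<in>{1..m}. 0 < (v i - r) \<bullet> n}
    (cover_map m v r \<phi>) (\<lambda>_. c)"
proof (cases "\<forall>n. n \<noteq> 0 \<longrightarrow> (\<exists>i\<in>{1..m}. 0 < (v i - r) \<bullet> n)")
  case True
  then have "sphere 0 1 \<subseteq> {n. \<exists>i\<in>{1..m}. 0 < (v i - r) \<bullet> n}"
    by (metis (mono_tags, lifting) mem_Collect_eq mem_sphere_0 norm_zero subsetI zero_neq_one)
  then show ?thesis
    using homotopic_with_subset_right[OF null] by blast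
next
  case False
  then obtain u where u: "u \<noteq> 0" "\<And>i. i \<in> {1..m} \<Longrightarrow> (v i - r) \<bullet> u \<le> 0"
    by (auto simp: not_less)
  define w where "w = - u"
  have w: "w \<noteq> 0" "\<And>i. i \<in> {1..m} \<Longrightarrow> 0 \<le> (v i - r) \<bullet> w"
    using u by (simp_all add: w_def)
  have "\<exists>j\<in>{1..m}. 0 < (v j - r) \<bullet> w"
  proof (rule ccontr)
    assume "\<not> ?thesis"
    then have "\<forall>i\<in>{1..m}. (v i - r) \<bullet> w = 0"
      using w(2) by force
    then have "v ` {1..m} \<subseteq> {x. w \<bullet> x = w \<bullet> r}"
      by (auto simp: inner_diff_left inner_diff_right inner_commute)
    then have "aff_dim (v ` {1..m}) \<le> aff_dim {x. w \<bullet> x = w \<bullet> r}"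
      by (rule aff_dim_subset)
    also have "\<dots> = int DIM('a) - 1"
      using w(1) by simp
    finally have "aff_dim (v ` {1..m}) \<le> int DIM('a) - 1" .
    with dim show False by simp
  qed
  then obtain j where j: "j \<in> {1..m}" "0 < (v j - r) \<bullet> w" by blast
  have "homotopic_with_canon (\<lambda>_. True) T {n. \<exists>i\<in>{1..m}. 0 < (v i - r) \<bullet> n}
    (cover_map m v r \<phi>) (\<lambda>_. v j - r)"
  proof (rule homotopic_with_linear[OF cover_map_into_sphere(1)[OF nb \<phi>] continuous_on_const], rule subsetI)
    fix x z assume x: "x \<in> T" and z: "z \<in> closed_segment (cover_map m v r \<phi> x) (v j - r)"
    let ?f = "cover_map m v r \<phi> x"
    \<comment> \<open>If \<open>z\<close> were not positive, then neither end of the segment would have positive inner product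
      with \<open>z\<close>, so \<open>z = 0\<close>; pairing with \<open>w\<close> then puts \<open>z\<close> at the end \<open>?f\<close>, which is a unit vector.\<close>
    obtain s where s: "0 \<le> s" "?f = (\<Sum>i=1..m. (s * \<phi> i x) *\<^sub>R (v i - r))"
      using cover_map_cone[OF \<phi> x] by blast
    have inner_f: "?f \<bullet> y = (\<Sum>i=1..m. s * \<phi> i x * ((v i - r) \<bullet> y))" for y
      by (simp add: s(2) inner_sum_left)
    have \<phi>_nonneg: "0 \<le> s * \<phi> i x" if "i \<in> {1..m}" for i
      using \<phi> x s(1) that by (simp add: partition_of_unity_def)
    obtain t where t: "0 \<le> t" "t \<le> 1" "z = (1 - t) *\<^sub>R ?f + t *\<^sub>R (v j - r)"
      using z by (auto simp: in_segment)
    show "z \<in> {n. \<exists>i\<in>{1..m}. 0 < (v i - r) \<bullet> n}"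
    proof (rule ccontr)
      assume "\<not> ?thesis"
      then have neg: "(v i - r) \<bullet> z \<le> 0" if "i \<in> {1..m}" for i
        using that by (auto simp: not_less)
      have "?f \<bullet> z \<le> 0"
        unfolding inner_f using neg \<phi>_nonneg by (intro sum_nonpos mult_nonneg_nonpos) auto
      have "z \<bullet> z = (1 - t) * (?f \<bullet> z) + t * ((v j - r) \<bullet> z)"
        by (subst (1) t(3)) (simp only: inner_add_left inner_scaleR_left)
      also have "\<dots> \<le> 0"
        using t \<open>?f \<bullet> z \<le> 0\<close> neg[OF j(1)] by (intro add_nonpos_nonpos mult_nonneg_nonpos) auto
      finally have "z = 0"
        by (metis antisym inner_eq_zero_iff inner_ge_zero)
      have "0 \<le> ?f \<bullet> w"
        unfolding inner_f by (intro sum_nonneg mult_nonneg_nonneg[OF \<phi>_nonneg w(2)])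
      moreover have "(1 - t) * (?f \<bullet> w) + t * ((v j - r) \<bullet> w) = 0"
        using \<open>z = 0\<close> t(3) by (metis inner_add_left inner_scaleR_left inner_zero_left)
      ultimately have "t * ((v j - r) \<bullet> w) \<le> 0"
        using t by (smt (verit) mult_nonneg_nonneg)
      then have "t = 0"
        using t(1) j(2) by (auto simp: mult_le_0_iff)
      then have "?f = 0"
        using t(3) \<open>z = 0\<close> by simp
      moreover have "?f \<in> sphere 0 1"
        using cover_map_into_sphere(2)[OF nb \<phi>] x by (rule funcset_mem)
      ultimately show False by simp
    qed
  qed
  then show ?thesis ..
qed

text \<open>Scores are the form in which a null-homotopy is turned into covers of the ball: at each point
  the positive scores single out an unbalanced nonempty set of indices, and on the sphere this set
  is one of the simplices allowed by \<open>U\<close>.\<close>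

definition unbalanced_scores ::
    "nat \<Rightarrow> (nat \<Rightarrow> 'a::real_vector) \<Rightarrow> 'a \<Rightarrow> (nat \<Rightarrow> 'b::real_normed_vector set)
       \<Rightarrow> (nat \<Rightarrow> 'b \<Rightarrow> real) \<Rightarrow> bool" where
  "unbalanced_scores m v r U b \<longleftrightarrow>
     (\<forall>i\<in>{1..m}. continuous_on (cball 0 1) (b i)) \<and>
     (\<forall>y\<in>cball 0 1. (\<exists>i\<in>{1..m}. 0 < b i y) \<and> r \<notin> convex hull (v ` {i\<in>{1..m}. 0 < b i y})) \<and>
     (\<forall>x\<in>sphere 0 1. \<forall>i\<in>{1..m}. 0 < b i x \<longrightarrow> x \<in> U i)"

text \<open>Extend the cover map to a map \<open>n\<close> of the ball into positive directions, and the partition of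
  unity to nonnegative functions \<open>\<Phi> i\<close>. The score is the inner product \<open>(v i - r) \<bullet> n y\<close> with the
  weight \<open>\<Phi> i y + 1 - norm y\<close>: indices of positive score lie in an open half-space bounded by
  \<open>r\<close>, the weight does not interfere inside the ball, and on the sphere it discards all \<open>i\<close> with
  \<open>x \<notin> U i\<close>.\<close>

lemma null_homotopic_imp_unbalanced_scores:
  fixes v :: "nat \<Rightarrow> 'a::euclidean_space" and U :: "nat \<Rightarrow> 'b::euclidean_space set"
  assumes \<phi>: "partition_of_unity m (sphere 0 1) U \<phi>" and nb: "no_balanced_simplices m v r U"
    and null: "homotopic_with_canon (\<lambda>_. True) (sphere 0 1) (sphere 0 1) (cover_map m v r \<phi>) (\<lambda>_. a)"
    and dim: "aff_dim (v ` {1..m}) = int DIM('a)"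
  obtains b where "unbalanced_scores m v r U b"
proof -
  obtain n where n: "continuous_on (cball 0 1) n"
      "\<And>y. y \<in> cball 0 1 \<Longrightarrow> \<exists>i\<in>{1..m}. 0 < (v i - r) \<bullet> n y"
      "\<And>x. x \<in> sphere 0 1 \<Longrightarrow> n x = cover_map m v r \<phi> x"
    using null_homotopic_through_positive_directions[OF \<phi> nb null dim]
    unfolding nullhomotopic_from_sphere_extension by blast
  have "\<exists>g. continuous_on (cball 0 1) g \<and> (\<forall>x\<in>sphere 0 1. g x = \<phi> i x) \<and> (\<forall>y\<in>cball 0 1. 0 \<le> g y)"
    if i: "i \<in> {1..m}" for i
  proof -
    have "\<phi> i x \<in> cbox 0 1" if "x \<in> sphere 0 1" for x
    proof -
      have "\<phi> i x \<le> (\<Sum>j=1..m. \<phi> j x)"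
        using \<phi> i that by (intro member_le_sum) (auto simp: partition_of_unity_def)
      then show ?thesis
        using \<phi> i that by (simp add: partition_of_unity_def)
    qed
    moreover have "continuous_on (sphere 0 1) (\<phi> i)"
      using \<phi> i by (simp add: partition_of_unity_def)
    moreover have "closedin (top_of_set (cball 0 1)) (sphere (0::'b) 1)"
      by (intro closed_subset) auto
    ultimately obtain g where "continuous_on (cball 0 1) g" "\<And>x. x \<in> sphere 0 1 \<Longrightarrow> g x = \<phi> i x"
        "\<And>y. y \<in> cball 0 1 \<Longrightarrow> g y \<in> cbox 0 1"
      using Tietze_closed_interval_1[of "sphere 0 1" "\<phi> i" "cball 0 1" 0 1] by auto
    then show ?thesis by auto
  qed
  then obtain \<Phi> where \<Phi>: "\<And>i. i \<in> {1..m} \<Longrightarrow> continuous_on (cball 0 1) (\<Phi> i)"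
      "\<And>i x. i \<in> {1..m} \<Longrightarrow> x \<in> sphere 0 1 \<Longrightarrow> \<Phi> i x = \<phi> i x"
      "\<And>i y. i \<in> {1..m} \<Longrightarrow> y \<in> cball 0 1 \<Longrightarrow> 0 \<le> \<Phi> i y"
    by metis
  define b where "b i y = (\<Phi> i y + (1 - norm y)) * ((v i - r) \<bullet> n y)" for i y
  have weight: "0 \<le> \<Phi> i y + (1 - norm y)" if "i \<in> {1..m}" "y \<in> cball 0 1" for i y
    using \<Phi>(3)[OF that] that by simp
  have "continuous_on (cball 0 1) (b i)" if "i \<in> {1..m}" for i
    unfolding b_def using \<Phi>(1)[OF that] n(1) by (intro continuous_intros)
  moreover have "\<exists>i\<in>{1..m}. 0 < b i y" if y: "y \<in> cball 0 1" for y
  proof (cases "norm y = 1")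
    case True
    then have "y \<in> sphere 0 1" by simp
    then obtain t where t: "0 \<le> t" "n y = (\<Sum>i=1..m. (t * \<phi> i y) *\<^sub>R (v i - r))"
      using cover_map_cone[OF \<phi>, of y v r] n(3) by auto
    moreover have "n y \<noteq> 0"
      using n(2)[OF y] by auto
    moreover have "0 \<le> t * \<phi> i y" if "i \<in> {1..m}" for i
      using \<phi> \<open>y \<in> sphere 0 1\<close> that t(1) by (simp add: partition_of_unity_def)
    ultimately obtain i where i: "i \<in> {1..m}" "0 < t * \<phi> i y" "0 < (v i - r) \<bullet> n y"
      using positive_direction_exists[where n = "n y" and c = "\<lambda>i. t * \<phi> i y" and v = v and r = r and m = m]
      by blast
    then have "0 < \<phi> i y"
      using t(1) by (simp add: zero_less_mult_iff)
    with i have "0 < b i y"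
      using True \<Phi>(2)[OF i(1) \<open>y \<in> sphere 0 1\<close>] by (simp add: b_def)
    with i(1) show ?thesis ..
  next
    case False
    obtain i where i: "i \<in> {1..m}" "0 < (v i - r) \<bullet> n y"
      using n(2)[OF y] by blast
    moreover have "0 < \<Phi> i y + (1 - norm y)"
      using \<Phi>(3)[OF i(1) y] False y by simp
    ultimately show ?thesis
      unfolding b_def by (meson mult_pos_pos)
  qed
  moreover have "r \<notin> convex hull (v ` {i\<in>{1..m}. 0 < b i y})" if y: "y \<in> cball 0 1" for y
  proof -
    have "v ` {i\<in>{1..m}. 0 < b i y} \<subseteq> {x. n y \<bullet> x > n y \<bullet> r}"
    proof clarify
      fix i assume i: "i \<in> {1..m}" "0 < b i y"
      then have "0 < (v i - r) \<bullet> n y"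
        using weight[OF i(1) y] unfolding b_def by (auto simp: zero_less_mult_iff)
      then show "n y \<bullet> v i > n y \<bullet> r"
        by (simp add: inner_diff_left inner_diff_right inner_commute)
    qed
    then have "convex hull (v ` {i\<in>{1..m}. 0 < b i y}) \<subseteq> {x. n y \<bullet> x > n y \<bullet> r}"
      by (intro hull_minimal convex_halfspace_gt)
    then show ?thesis by blast
  qed
  moreover have "x \<in> U i" if x: "x \<in> sphere 0 1" and i: "i \<in> {1..m}" "0 < b i x" for x i
  proof -
    have "\<phi> i x \<noteq> 0"
      using i x \<Phi>(2)[OF i(1) x] by (auto simp: b_def)
    then show ?thesis
      using partition_of_unity_in_cover[OF \<phi> i(1) x] by blast
  qed
  ultimately have "unbalanced_scores m v r U b"
    unfolding unbalanced_scores_def by blast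
  then show thesis ..
qed

section \<open>Covers of the ball from scores\<close>

text \<open>This map stretches the inner ball of radius \<open>1/2\<close> onto the unit ball, where the scores
  live, and projects the collar \<open>norm y \<ge> 1/2\<close> to the sphere, where the cover to be extended
  lives.\<close>

definition collar_map :: "'b::real_normed_vector \<Rightarrow> 'b" where
  "collar_map y = (2 / max 1 (2 * norm y)) *\<^sub>R y"

lemma continuous_on_collar_map: "continuous_on (S :: 'b::real_normed_vector set) collar_map"
proof -
  have "continuous_on S (\<lambda>y::'b. (2 / max 1 (2 * norm y)) *\<^sub>R y)"
    by (intro continuous_intros) (smt (verit))
  then show ?thesis
    by (simp add: collar_map_def[abs_def])
qed

lemma norm_collar_map: "norm (collar_map y) = min 1 (2 * norm y)"
  by (auto simp: collar_map_def max_def min_def)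

lemma collar_map_sphere: "norm y = 1 \<Longrightarrow> collar_map y = y"
  by (simp add: collar_map_def)

lemma collar_map_in_cball: "collar_map y \<in> cball 0 1"
  by (simp add: norm_collar_map)

lemma collar_map_in_sphere: "1/2 \<le> norm y \<Longrightarrow> collar_map y \<in> sphere 0 1"
  by (simp add: norm_collar_map)

lemma continuous_on_score_collar:
  assumes "unbalanced_scores m v r U b" "i \<in> {1..m}"
  shows "continuous_on (cball 0 1) (\<lambda>y. b i (collar_map y))"
  using assms collar_map_in_cball
  by (intro continuous_on_compose2[OF _ continuous_on_collar_map]) (auto simp: unbalanced_scores_def)

text \<open>In the open collar the sets of positive score are contained in the members pulled back from
  the sphere, so each point of the ball sees either a simplex of the given nerve or a set of
  indices with positive scores.\<close>

lemma open_cover_extension_from_scores: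
  fixes F :: "nat \<Rightarrow> 'b::euclidean_space set"
  assumes F: "open_cover m (sphere 0 1) F" "no_balanced_simplices m v r F"
    and b: "unbalanced_scores m v r F b"
  obtains G where "open_cover m (cball 0 1) G" "extends_cover m (sphere 0 1) F G"
    "no_balanced_simplices m v r G"
proof -
  let ?p = "collar_map :: 'b \<Rightarrow> 'b"
  define G where "G i = {y\<in>cball 0 1. 0 < b i (?p y)} \<union> {y\<in>cball 0 1. 1/2 < norm y \<and> ?p y \<in> F i}" for i
  have F_sub: "F i \<subseteq> sphere 0 1" if "i \<in> {1..m}" for i
    using F(1) that unfolding open_cover_def by blast
  have score_in_F: "?p y \<in> F i" if "i \<in> {1..m}" "1/2 \<le> norm y" "0 < b i (?p y)" for i y
    using b that collar_map_in_sphere unfolding unbalanced_scores_def by blast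
  have "openin (top_of_set (cball 0 1)) (G i)" if i: "i \<in> {1..m}" for i
  proof -
    obtain O' where O': "open O'" "F i = sphere 0 1 \<inter> O'"
      using F(1) i unfolding open_cover_def openin_open by blast
    let ?A = "cball 0 1 \<inter> (\<lambda>y. b i (?p y)) -` {0<..}"
    let ?B = "cball 0 1 \<inter> (\<lambda>y. (norm y, ?p y)) -` ({1/2<..} \<times> O')"
    have "openin (top_of_set (cball 0 1)) ?A"
      by (intro continuous_openin_preimage_gen continuous_on_score_collar[OF b i]) auto
    moreover have "openin (top_of_set (cball 0 1)) ?B"
      using O'(1)
      by (intro continuous_openin_preimage_gen continuous_intros continuous_on_collar_map open_Times) auto
    ultimately have "openin (top_of_set (cball 0 1)) (?A \<union> ?B)"
      by (rule openin_Un)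
    moreover have "G i = ?A \<union> ?B"
    proof -
      have "?p y \<in> F i \<longleftrightarrow> ?p y \<in> O'" if "1/2 < norm y" for y
        using O'(2) collar_map_in_sphere[of y] that by auto
      then show ?thesis
        by (auto simp: G_def)
    qed
    ultimately show ?thesis
      by (simp only:)
  qed
  moreover have "(\<Union>i\<in>{1..m}. G i) = cball 0 1"
  proof
    show "cball 0 1 \<subseteq> (\<Union>i\<in>{1..m}. G i)"
      using b collar_map_in_cball unfolding unbalanced_scores_def G_def by blast
  qed (auto simp: G_def)
  ultimately have "open_cover m (cball 0 1) G"
    by (simp add: open_cover_def)
  moreover have "extends_cover m (sphere 0 1) F G"
    unfolding extends_cover_def
  proof
    fix i assume i: "i \<in> {1..m}"
    have "x \<in> F i \<longleftrightarrow> x \<in> G i" if "x \<in> sphere 0 1" for x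
      using that score_in_F[OF i, of x] by (auto simp: G_def collar_map_sphere)
    then show "F i = G i \<inter> sphere 0 1"
      using F_sub[OF i] by blast
  qed
  moreover have "no_balanced_simplices m v r G"
    unfolding no_balanced_simplices_iff
  proof
    fix y
    show "r \<notin> convex hull (v ` {i\<in>{1..m}. y \<in> G i})"
    proof (cases "1/2 < norm y")
      case True
      then have "{i\<in>{1..m}. y \<in> G i} \<subseteq> {i\<in>{1..m}. ?p y \<in> F i}"
        using score_in_F[of _ y] by (auto simp: G_def)
      moreover have "r \<notin> convex hull (v ` {i\<in>{1..m}. ?p y \<in> F i})"
        using F(2) by (simp add: no_balanced_simplices_iff)
      ultimately show ?thesis
        by (rule unbalanced_subset)
    next
      case False
      then have "{i\<in>{1..m}. y \<in> G i} \<subseteq> {i\<in>{1..m}. 0 < b i (?p y)}"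
        by (auto simp: G_def)
      moreover have "r \<notin> convex hull (v ` {i\<in>{1..m}. 0 < b i (?p y)})"
        using b collar_map_in_cball unfolding unbalanced_scores_def by blast
      ultimately show ?thesis
        by (rule unbalanced_subset)
    qed
  qed
  ultimately show thesis ..
qed

text \<open>For closed covers the positive score sets are replaced by the closed sets of maximal score, in
  the inner ball only. On the inner boundary of the collar these still lie in the pulled-back
  members of the swelling \<open>U\<close>, as do those of \<open>C\<close>.\<close>

lemma closed_cover_extension_from_scores:
  fixes C :: "nat \<Rightarrow> 'b::euclidean_space set"
  assumes C: "closed_cover m (sphere 0 1) C" and CU: "\<And>i. i \<in> {1..m} \<Longrightarrow> C i \<subseteq> U i"
    and U: "no_balanced_simplices m v r U"
    and b: "unbalanced_scores m v r U b"
  obtains G where "closed_cover m (cball 0 1) G" "extends_cover m (sphere 0 1) C G"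
    "no_balanced_simplices m v r G"
proof -
  let ?p = "collar_map :: 'b \<Rightarrow> 'b"
  define G where "G i = {y\<in>cball 0 1. norm y \<le> 1/2 \<and> (\<forall>j\<in>{1..m}. b j (?p y) \<le> b i (?p y))} \<union>
      {y\<in>cball 0 1. 1/2 \<le> norm y \<and> ?p y \<in> C i}" for i
  have C_sub: "C i \<subseteq> sphere 0 1" if "i \<in> {1..m}" for i
    using C that unfolding closed_cover_def by blast
  have max_pos: "0 < b i (?p y)" if "\<forall>j\<in>{1..m}. b j (?p y) \<le> b i (?p y)" for i y
    using b collar_map_in_cball[of y] that unfolding unbalanced_scores_def by fastforce
  have "closedin (top_of_set (cball 0 1)) (G i)" if i: "i \<in> {1..m}" for i
  proof -
    have C_closed: "closed (C i)"
      using C i closedin_closed_trans[of "sphere 0 1" "C i"] unfolding closed_cover_def by auto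
    have diff: "closed ((\<lambda>y. b i (?p y) - b j (?p y)) -` {0..} \<inter> cball 0 1)" if "j \<in> {1..m}" for j
      by (intro closed_vimage_Int continuous_intros continuous_on_score_collar[OF b] i that) auto
    have "closed ((cball 0 1 \<inter> cball 0 (1/2)) \<inter>
        (\<Inter>j\<in>{1..m}. (\<lambda>y. b i (?p y) - b j (?p y)) -` {0..} \<inter> cball 0 1))"
      using diff by (intro closed_Int closed_INT) auto
    moreover have "closed ((\<lambda>y. (norm y, ?p y)) -` ({1/2..} \<times> C i) \<inter> cball 0 1)"
      using C_closed
      by (intro closed_vimage_Int continuous_intros continuous_on_collar_map closed_Times) auto
    moreover have "G i = ((cball 0 1 \<inter> cball 0 (1/2)) \<inter>
          (\<Inter>j\<in>{1..m}. (\<lambda>y. b i (?p y) - b j (?p y)) -` {0..} \<inter> cball 0 1)) \<union>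
        ((\<lambda>y. (norm y, ?p y)) -` ({1/2..} \<times> C i) \<inter> cball 0 1)"
      by (auto simp: G_def)
    ultimately have "closed (G i)"
      by (simp only: closed_Un)
    then show ?thesis
      by (intro closed_subset) (auto simp: G_def)
  qed
  moreover have "(\<Union>i\<in>{1..m}. G i) = cball 0 1"
  proof
    show "cball 0 1 \<subseteq> (\<Union>i\<in>{1..m}. G i)"
    proof
      fix y :: 'b assume y: "y \<in> cball 0 1"
      show "y \<in> (\<Union>i\<in>{1..m}. G i)"
      proof (cases "1/2 \<le> norm y")
        case True
        then have "?p y \<in> (\<Union>i\<in>{1..m}. C i)"
          using C collar_map_in_sphere[of y] by (simp add: closed_cover_def)
        then show ?thesis
          using y True by (auto simp: G_def)
      next
        case False
        let ?B = "(\<lambda>j. b j (?p y)) ` {1..m}"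
        have "?B \<noteq> {}"
          using b collar_map_in_cball[of y] unfolding unbalanced_scores_def by blast
        then have "Max ?B \<in> ?B"
          by (intro Max_in) auto
        then obtain i where i: "i \<in> {1..m}" "Max ?B = b i (?p y)"
          by blast
        have "b j (?p y) \<le> b i (?p y)" if "j \<in> {1..m}" for j
          unfolding i(2)[symmetric] using that by (intro Max_ge) auto
        then have "y \<in> G i"
          using y False by (simp add: G_def)
        with i(1) show ?thesis by blast
      qed
    qed
  qed (auto simp: G_def)
  ultimately have "closed_cover m (cball 0 1) G"
    by (simp add: closed_cover_def)
  moreover have "extends_cover m (sphere 0 1) C G"
    unfolding extends_cover_def
  proof
    fix i assume i: "i \<in> {1..m}"
    have "x \<in> C i \<longleftrightarrow> x \<in> G i" if "x \<in> sphere 0 1" for x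
      using that by (simp add: G_def collar_map_sphere)
    then show "C i = G i \<inter> sphere 0 1"
      using C_sub[OF i] by blast
  qed
  moreover have "no_balanced_simplices m v r G"
    unfolding no_balanced_simplices_iff
  proof
    fix y
    show "r \<notin> convex hull (v ` {i\<in>{1..m}. y \<in> G i})"
    proof (cases "1/2 \<le> norm y")
      case True
      have "?p y \<in> U i" if i: "i \<in> {1..m}" and y: "y \<in> G i" for i
      proof -
        consider "?p y \<in> C i" | "0 < b i (?p y)"
          using y max_pos[where i = i and y = y] by (auto simp: G_def)
        then show ?thesis
          using b i CU[OF i] collar_map_in_sphere[OF True] unfolding unbalanced_scores_def
          by cases blast+
      qed
      then have "{i\<in>{1..m}. y \<in> G i} \<subseteq> {i\<in>{1..m}. ?p y \<in> U i}"
        by blast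
      moreover have "r \<notin> convex hull (v ` {i\<in>{1..m}. ?p y \<in> U i})"
        using U by (simp add: no_balanced_simplices_iff)
      ultimately show ?thesis
        by (rule unbalanced_subset)
    next
      case False
      have "0 < b i (?p y)" if "y \<in> G i" for i
      proof (rule max_pos)
        show "\<forall>j\<in>{1..m}. b j (?p y) \<le> b i (?p y)"
          using that False by (simp add: G_def)
      qed
      then have "{i\<in>{1..m}. y \<in> G i} \<subseteq> {i\<in>{1..m}. 0 < b i (?p y)}"
        by blast
      moreover have "r \<notin> convex hull (v ` {i\<in>{1..m}. 0 < b i (?p y)})"
        using b collar_map_in_cball unfolding unbalanced_scores_def by blast
      ultimately show ?thesis
        by (rule unbalanced_subset)
    qed
  qed
  ultimately show thesis ..
qed

section \<open>Extendability and the homotopy class\<close>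

lemma cover_map_null_homotopic_on_sphere:
  fixes G :: "nat \<Rightarrow> 'b::euclidean_space set"
  assumes "no_balanced_simplices m v r G" "partition_of_unity m (cball 0 1) G \<psi>"
  shows "\<exists>a. homotopic_with_canon (\<lambda>_. True) (sphere 0 1) (sphere 0 1) (cover_map m v r \<psi>) (\<lambda>_. a)"
  unfolding nullhomotopic_from_sphere_extension
  using cover_map_into_sphere[OF assms] by blast

text \<open>A partition of unity subordinate to an extension restricts to one subordinate to \<open>F\<close>, and its
  cover map factors through the ball. The converse goes through scores.\<close>

lemma open_cover_extends_iff:
  fixes v :: "nat \<Rightarrow> 'a::euclidean_space" and F :: "nat \<Rightarrow> 'b::euclidean_space set"
  assumes dim: "aff_dim (v ` {1..m}) = int DIM('a)"
    and F: "open_cover m (sphere 0 1) F" "no_balanced_simplices m v r F"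
  shows "(\<exists>G. open_cover m (cball 0 1) G \<and> extends_cover m (sphere 0 1) F G \<and>
              no_balanced_simplices m v r G) \<longleftrightarrow>
         null_class (sphere 0 1) (sphere 0 1) (open_cover_class m v r (sphere 0 1) F)"
proof
  assume "\<exists>G. open_cover m (cball 0 1) G \<and> extends_cover m (sphere 0 1) F G \<and>
              no_balanced_simplices m v r G"
  then obtain G where G: "open_cover m (cball 0 1) G" "extends_cover m (sphere 0 1) F G"
      "no_balanced_simplices m v r G" by (elim exE conjE)
  obtain \<psi> where \<psi>: "partition_of_unity m (cball 0 1) G \<psi>"
    using partition_of_unity_exists[OF G(1)] .
  have "partition_of_unity m (sphere 0 1) (\<lambda>i. G i \<inter> sphere 0 1) \<psi>"
    by (rule partition_of_unity_restrict[OF \<psi>]) auto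
  then have "partition_of_unity m (sphere 0 1) F \<psi>"
    by (rule partition_of_unity_cover_mono) (use G(2) in \<open>auto simp: extends_cover_def\<close>)
  then show "null_class (sphere 0 1) (sphere 0 1) (open_cover_class m v r (sphere 0 1) F)"
    using null_open_cover_class_iff[OF _ F(2)] cover_map_null_homotopic_on_sphere[OF G(3) \<psi>]
    by fastforce
next
  assume null: "null_class (sphere 0 1) (sphere 0 1) (open_cover_class m v r (sphere 0 1) F)"
  obtain \<phi> where \<phi>: "partition_of_unity m (sphere 0 1) F \<phi>"
    using partition_of_unity_exists[OF F(1)] .
  then obtain a where
    "homotopic_with_canon (\<lambda>_. True) (sphere 0 1) (sphere 0 1) (cover_map m v r \<phi>) (\<lambda>_. a)"
    using null null_open_cover_class_iff[OF _ F(2) \<phi>] by fastforce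
  then obtain b where "unbalanced_scores m v r F b"
    using null_homotopic_imp_unbalanced_scores[OF \<phi> F(2) _ dim] by blast
  then show "\<exists>G. open_cover m (cball 0 1) G \<and> extends_cover m (sphere 0 1) F G \<and>
      no_balanced_simplices m v r G"
    using open_cover_extension_from_scores[OF F] by metis
qed

text \<open>A swelling \<open>W\<close> of an extension restricts to an open cover \<open>U\<close> of the sphere that contains \<open>C\<close>
  and has no balanced simplices. The nerve of \<open>U\<close> may well be larger than that of \<open>C\<close>, which is why
  the class of \<open>C\<close> is compared with such covers and not only with those of the same nerve.\<close>

lemma closed_cover_extends_iff:
  fixes v :: "nat \<Rightarrow> 'a::euclidean_space" and C :: "nat \<Rightarrow> 'b::euclidean_space set"
  assumes dim: "aff_dim (v ` {1..m}) = int DIM('a)"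
    and C: "closed_cover m (sphere 0 1) C" "no_balanced_simplices m v r C"
  shows "(\<exists>G. closed_cover m (cball 0 1) G \<and> extends_cover m (sphere 0 1) C G \<and>
              no_balanced_simplices m v r G) \<longleftrightarrow>
         null_class (sphere 0 1) (sphere 0 1) (closed_cover_class m v r (sphere 0 1) C)"
proof
  assume "\<exists>G. closed_cover m (cball 0 1) G \<and> extends_cover m (sphere 0 1) C G \<and>
              no_balanced_simplices m v r G"
  then obtain G where G: "closed_cover m (cball 0 1) G" "extends_cover m (sphere 0 1) C G"
      "no_balanced_simplices m v r G" by (elim exE conjE)
  obtain W where W: "open_cover m (cball 0 1) W" "\<And>i. i \<in> {1..m} \<Longrightarrow> G i \<subseteq> W i" "nerve m W = nerve m G"
    using closed_cover_swelling[OF compact_cball G(1)] by blast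
  have nbW: "no_balanced_simplices m v r W"
    using G(3) W(3) by (simp add: no_balanced_simplices_def)
  obtain \<psi> where \<psi>: "partition_of_unity m (cball 0 1) W \<psi>"
    using partition_of_unity_exists[OF W(1)] .
  define U where "U i = W i \<inter> sphere 0 1" for i
  have \<psi>': "partition_of_unity m (sphere 0 1) U \<psi>"
    unfolding U_def by (rule partition_of_unity_restrict[OF \<psi>]) auto
  have nbU: "no_balanced_simplices m v r U"
    by (rule no_balanced_simplices_mono[OF nbW]) (auto simp: U_def)
  have CU: "C i \<subseteq> U i" if "i \<in> {1..m}" for i
    using G(2) W(2)[OF that] that by (auto simp: extends_cover_def U_def)
  have "openin (top_of_set (sphere 0 1)) (U i)" if i: "i \<in> {1..m}" for i
  proof -
    obtain O' where "open O'" "W i = cball 0 1 \<inter> O'"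
      using W(1) i unfolding open_cover_def openin_open by blast
    then have "U i = sphere 0 1 \<inter> O'"
      by (auto simp: U_def)
    with \<open>open O'\<close> show ?thesis
      by (simp add: openin_open_Int)
  qed
  moreover have "(\<Union>i\<in>{1..m}. U i) = sphere 0 1"
  proof
    show "sphere 0 1 \<subseteq> (\<Union>i\<in>{1..m}. U i)"
      using CU C(1) unfolding closed_cover_def by blast
  qed (auto simp: U_def)
  ultimately have U: "open_cover m (sphere 0 1) U"
    by (simp add: open_cover_def)
  show "null_class (sphere 0 1) (sphere 0 1) (closed_cover_class m v r (sphere 0 1) C)"
    using null_closed_cover_class_iff[OF _ compact_sphere C U CU nbU \<psi>']
      cover_map_null_homotopic_on_sphere[OF nbW \<psi>] by fastforce
next
  assume null: "null_class (sphere 0 1) (sphere 0 1) (closed_cover_class m v r (sphere 0 1) C)"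
  obtain U where U: "open_cover m (sphere 0 1) U" "\<And>i. i \<in> {1..m} \<Longrightarrow> C i \<subseteq> U i" "nerve m U = nerve m C"
    using closed_cover_swelling[OF compact_sphere C(1)] by blast
  have nbU: "no_balanced_simplices m v r U"
    using C(2) U(3) by (simp add: no_balanced_simplices_def)
  obtain \<phi> where \<phi>: "partition_of_unity m (sphere 0 1) U \<phi>"
    using partition_of_unity_exists[OF U(1)] .
  obtain a where
    "homotopic_with_canon (\<lambda>_. True) (sphere 0 1) (sphere 0 1) (cover_map m v r \<phi>) (\<lambda>_. a)"
    using null null_closed_cover_class_iff[OF _ compact_sphere C U(1,2) nbU \<phi>] by fastforce
  then obtain b where "unbalanced_scores m v r U b"
    using null_homotopic_imp_unbalanced_scores[OF \<phi> nbU _ dim] by blast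
  then show "\<exists>G. closed_cover m (cball 0 1) G \<and> extends_cover m (sphere 0 1) C G \<and>
      no_balanced_simplices m v r G"
    using closed_cover_extension_from_scores[OF C(1) U(2) nbU] by metis
qed

theorem theorem2:
  fixes v :: "nat \<Rightarrow> 'a::euclidean_space" and r :: 'a
    and F :: "nat \<Rightarrow> 'b::euclidean_space set"
    and d k m :: nat
  assumes "DIM('a) = d" and "DIM('b) = k + 1"
    and "aff_dim (convex hull (v ` {1..m})) = int d"
    and "no_balanced_simplices m v r F"
  shows
    "(open_cover m (sphere 0 1) F \<longrightarrow>
        ((\<exists>G. open_cover m (cball 0 1) G \<and> extends_cover m (sphere 0 1) F G \<and>
              no_balanced_simplices m v r G) \<longleftrightarrow>
         null_class (sphere 0 1) (sphere 0 1) (open_cover_class m v r (sphere 0 1) F))) \<and>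
     (closed_cover m (sphere 0 1) F \<longrightarrow>
        ((\<exists>G. closed_cover m (cball 0 1) G \<and> extends_cover m (sphere 0 1) F G \<and>
              no_balanced_simplices m v r G) \<longleftrightarrow>
         null_class (sphere 0 1) (sphere 0 1) (closed_cover_class m v r (sphere 0 1) F)))"
  using open_cover_extends_iff[of v m F r] closed_cover_extends_iff[of v m F r] assms
  by (simp add: aff_dim_convex_hull)

end
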